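(* Let $K$ be an algebraically closed field, let $\varepsilon$ be a primitive cube root of $1$ if $\operatorname{char}K\neq 3$ and $\varepsilon=1$ if $\operatorname{char}K=3$, and let $p\in K\langle x_1,\dots,x_m\rangle$ be multilinear. Suppose there exist $\alpha,\beta,\gamma\in K$ with $\alpha+\beta+\gamma\neq0$, $\alpha+\beta\varepsilon+\gamma\varepsilon^2\neq0$, $\alpha+\beta\varepsilon^2+\gamma\varepsilon\neq0$, and matrix units $e_1,\dots,e_m\in M_3(K)$ such that $p(e_1,\dots,e_m)$ has eigenvalues $\alpha,\beta,\gamma$. Then $\operatorname{Im} p$ (evaluated on $M_3(K)$) is Zariski dense in $M_3(K)$.
   Context: A polynomial is multilinear if it has the form $\sum_{\sigma\in S_m}c_\sigma x_{\sigma(1)}\cdots x_{\sigma(m)}$. Matrix units are the matrices $e_{i,j}$ with $1$ in position $(i,j)$ and $0$ elsewhere. *)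

theory Defs
  imports "Jordan_Normal_Form.Char_Poly" "HOL-Combinatorics.Permutations"
begin

definition matrix_unit :: "nat \<Rightarrow> nat \<Rightarrow> nat \<Rightarrow> 'a::comm_ring_1 mat" where
  "matrix_unit n i j = mat n n (\<lambda>(k,l). if k = i \<and> l = j then 1 else 0)"

definition is_matrix_unit :: "nat \<Rightarrow> 'a::comm_ring_1 mat \<Rightarrow> bool" where
  "is_matrix_unit n E \<longleftrightarrow> (\<exists>i<n. \<exists>j<n. E = matrix_unit n i j)"

definition prod_list_mat :: "nat \<Rightarrow> 'a::comm_ring_1 mat list \<Rightarrow> 'a mat" where
  "prod_list_mat n As = foldr (*) As (1\<^sub>m n)"

(* A multilinear polynomial p = \<Sum>_{\<sigma> \<in> S_m} c \<sigma> x_{\<sigma>(0)} ... x_{\<sigma>(m-1)}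
   (variables indexed 0..m-1) is given by its coefficient function c on permutations of {..<m}.
   Evaluation at n x n matrices A 0, ..., A (m-1): *)
definition multilin_eval :: "nat \<Rightarrow> nat \<Rightarrow> ((nat \<Rightarrow> nat) \<Rightarrow> 'a::comm_ring_1)
    \<Rightarrow> (nat \<Rightarrow> 'a mat) \<Rightarrow> 'a mat" where
  "multilin_eval n m c A = mat n n (\<lambda>(k,l).
     \<Sum>\<sigma>\<in>{\<sigma>. \<sigma> permutes {..<m}}. c \<sigma> * prod_list_mat n (map (\<lambda>t. A (\<sigma> t)) [0..<m]) $$ (k,l))"

definition multilin_image :: "nat \<Rightarrow> nat \<Rightarrow> ((nat \<Rightarrow> nat) \<Rightarrow> 'a::comm_ring_1) \<Rightarrow> 'a mat set" where
  "multilin_image n m c = {multilin_eval n m c A | A. \<forall>i<m. A i \<in> carrier_mat n n}"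

(* Polynomials in the n^2 entries of an n x n matrix: coefficient function on exponent
   vectors e :: nat \<times> nat \<Rightarrow> nat (exponent of entry (i,j)), with finite support. *)
definition entry_poly :: "nat \<Rightarrow> ((nat \<times> nat \<Rightarrow> nat) \<Rightarrow> 'a::comm_ring_1) \<Rightarrow> bool" where
  "entry_poly n f \<longleftrightarrow> finite {e. f e \<noteq> 0} \<and>
     (\<forall>e. f e \<noteq> 0 \<longrightarrow> (\<forall>i j. (i \<ge> n \<or> j \<ge> n) \<longrightarrow> e (i,j) = 0))"

definition entry_poly_eval :: "nat \<Rightarrow> ((nat \<times> nat \<Rightarrow> nat) \<Rightarrow> 'a::comm_ring_1) \<Rightarrow> 'a mat \<Rightarrow> 'a" where
  "entry_poly_eval n f A = (\<Sum>e\<in>{e. f e \<noteq> 0}. f e * (\<Prod>ij\<in>{..<n} \<times> {..<n}. (A $$ ij) ^ e ij))"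

definition zariski_dense_mat :: "nat \<Rightarrow> 'a::comm_ring_1 mat set \<Rightarrow> bool" where
  "zariski_dense_mat n S \<longleftrightarrow> S \<subseteq> carrier_mat n n \<and>
     (\<forall>f. entry_poly n f \<longrightarrow> (\<forall>A\<in>S. entry_poly_eval n f A = 0) \<longrightarrow> (\<forall>e. f e = 0))"

end

theory Submission
  imports Defs
begin

text \<open>
  A matrix unit \<open>e\<^bsub>k,l\<^esub>\<close> is homogeneous of degree \<open>l - k\<close> for the \<open>\<int>/3\<close>-grading of \<open>M\<^sub>3(K)\<close>, so
  \<open>p(e\<^sub>1, \<dots>, e\<^sub>m)\<close> is homogeneous; having nonzero trace, it is diagonal. Hence \<open>p\<close> maps the
  product of the homogeneous components of the \<open>e\<^sub>i\<close> into the diagonal matrices. The hypotheses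
  on \<open>\<alpha>, \<beta>, \<gamma>\<close> say that a circulant determinant is nonzero, i.e. that \<open>diag(\<alpha>, \<beta>, \<gamma>)\<close> and its cyclic
  rotations, which are also values of \<open>p\<close>, span the diagonal matrices.

  A multilinear map into \<open>K\<^sup>3\<close> with spanning image is dominant: its image contains a plane, and if
  it were not dense its closure, being irreducible, would equal that plane. So every polynomial
  vanishing on the image of \<open>p\<close> vanishes on the diagonal matrices, by conjugation invariance on
  all diagonalizable matrices, and therefore everywhere.
\<close>

section \<open>Polynomial functions\<close>

text \<open>Over a finite field, adding 1 to the product of all \<open>X - a\<close> would give a
  polynomial of positive degree without roots.\<close>

lemma infinite_UNIV_alg_closed: "infinite (UNIV :: 'a::alg_closed_field set)"
proof
  assume fin: "finite (UNIV :: 'a set)"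
  define p :: "'a poly" where "p = (\<Prod>a\<in>UNIV. [:-a, 1:])"
  have "degree p = card (UNIV :: 'a set)"
    unfolding p_def by (subst degree_prod_sum_eq) auto
  moreover have "card (UNIV :: 'a set) > 0"
    using fin by (simp add: card_gt_0_iff)
  ultimately have "degree (p + 1) > 0"
    by (subst degree_add_eq_left) auto
  then obtain x where "poly (p + 1) x = 0"
    using alg_closed_imp_poly_has_root by blast
  moreover have "poly p x = 0"
    using fin by (auto simp: p_def poly_prod intro: prod_zero)
  ultimately show False by simp
qed

text \<open>Expressing polynomial dependence as membership in a set of functions lets the same
  closure rules serve for one and for three variables.\<close>

definition function_subalgebra :: "('b \<Rightarrow> 'a::comm_ring_1) set \<Rightarrow> bool" where
  "function_subalgebra H \<longleftrightarrow> (\<forall>c. (\<lambda>_. c) \<in> H) \<and>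
     (\<forall>f\<in>H. \<forall>g\<in>H. (\<lambda>x. f x + g x) \<in> H) \<and> (\<forall>f\<in>H. \<forall>g\<in>H. (\<lambda>x. f x * g x) \<in> H)"

context
  fixes H :: "('b \<Rightarrow> 'a::comm_ring_1) set"
  assumes H: "function_subalgebra H"
begin

lemma subalgebra_const: "(\<lambda>_. c) \<in> H"
  using H by (auto simp: function_subalgebra_def)

lemma subalgebra_add: "f \<in> H \<Longrightarrow> g \<in> H \<Longrightarrow> (\<lambda>x. f x + g x) \<in> H"
  using H by (auto simp: function_subalgebra_def)

lemma subalgebra_mult: "f \<in> H \<Longrightarrow> g \<in> H \<Longrightarrow> (\<lambda>x. f x * g x) \<in> H"
  using H by (auto simp: function_subalgebra_def)

lemma subalgebra_diff: "f \<in> H \<Longrightarrow> g \<in> H \<Longrightarrow> (\<lambda>x. f x - g x) \<in> H"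
  using subalgebra_add[of f "\<lambda>x. (-1) * g x"] subalgebra_mult[of "\<lambda>_. -1" g] subalgebra_const[of "-1"]
  by simp

lemma subalgebra_power: "f \<in> H \<Longrightarrow> (\<lambda>x. f x ^ n) \<in> H"
  by (induction n) (simp_all add: subalgebra_const subalgebra_mult)

lemma subalgebra_sum: "(\<And>i. i \<in> I \<Longrightarrow> f i \<in> H) \<Longrightarrow> (\<lambda>x. \<Sum>i\<in>I. f i x) \<in> H"
  by (induction I rule: infinite_finite_induct) (simp_all add: subalgebra_const subalgebra_add)

lemma subalgebra_prod: "(\<And>i. i \<in> I \<Longrightarrow> f i \<in> H) \<Longrightarrow> (\<lambda>x. \<Prod>i\<in>I. f i x) \<in> H"
  by (induction I rule: infinite_finite_induct) (simp_all add: subalgebra_const subalgebra_mult)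

lemma subalgebra_entry_poly_eval:
  assumes "\<And>i j. i < n \<Longrightarrow> j < n \<Longrightarrow> (\<lambda>x. M x $$ (i, j)) \<in> H"
  shows "(\<lambda>x. entry_poly_eval n f (M x)) \<in> H"
  unfolding entry_poly_eval_def
  by (intro subalgebra_sum subalgebra_mult subalgebra_const subalgebra_prod subalgebra_power)
     (use assms in auto)

lemma subalgebra_poly: "f \<in> H \<Longrightarrow> (\<lambda>b. poly p (f b)) \<in> H"
  by (induction p) (simp_all add: subalgebra_const subalgebra_add subalgebra_mult)

lemma subalgebra_poly2: "f \<in> H \<Longrightarrow> g \<in> H \<Longrightarrow> (\<lambda>b. poly (poly p [:g b:]) (f b)) \<in> H"
  by (induction p) (simp_all add: subalgebra_const subalgebra_add subalgebra_mult subalgebra_poly)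

lemma subalgebra_poly3:
  "f \<in> H \<Longrightarrow> g \<in> H \<Longrightarrow> h \<in> H \<Longrightarrow> (\<lambda>b. poly (poly (poly p [:[:h b:]:]) [:g b:]) (f b)) \<in> H"
  by (induction p) (simp_all add: subalgebra_const subalgebra_add subalgebra_mult subalgebra_poly2)

end

lemmas subalgebra_intros =
  subalgebra_const subalgebra_add subalgebra_mult subalgebra_diff subalgebra_sum subalgebra_prod

definition poly_fun :: "('a::comm_ring_1 \<Rightarrow> 'a) set" where
  "poly_fun = range poly"

lemma poly_fun_subalgebra: "function_subalgebra (poly_fun :: ('a::comm_ring_1 \<Rightarrow> 'a) set)"
  unfolding function_subalgebra_def
proof (intro conjI allI ballI)
  show "(\<lambda>_. c) \<in> poly_fun" for c :: 'a
    unfolding poly_fun_def by (rule image_eqI[of _ _ "[:c:]"]) auto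
next
  fix f g :: "'a \<Rightarrow> 'a"
  assume "f \<in> poly_fun" "g \<in> poly_fun"
  then obtain p q where "f = poly p" "g = poly q"
    unfolding poly_fun_def by auto
  then have "(\<lambda>x. f x + g x) = poly (p + q)" "(\<lambda>x. f x * g x) = poly (p * q)"
    by auto
  then show "(\<lambda>x. f x + g x) \<in> poly_fun" "(\<lambda>x. f x * g x) \<in> poly_fun"
    unfolding poly_fun_def by blast+
qed

lemma poly_fun_id: "(\<lambda>s. s) \<in> poly_fun"
proof -
  have "(\<lambda>s. s) = poly [:0, 1 :: 'a:]" by auto
  then show ?thesis unfolding poly_fun_def by blast
qed

lemmas poly_fun_intros = poly_fun_id subalgebra_intros[OF poly_fun_subalgebra]

lemma poly_fun_nonzero_finite_zeros:
  fixes \<psi> :: "'a::idom \<Rightarrow> 'a"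
  assumes "\<psi> \<in> poly_fun" "\<psi> t \<noteq> 0"
  shows "finite {s. \<psi> s = 0}"
proof -
  obtain p where p: "\<psi> = poly p" using assms(1) unfolding poly_fun_def by blast
  with assms(2) have "p \<noteq> 0" by auto
  then show ?thesis unfolding p by (rule poly_roots_finite)
qed

text \<open>If \<phi> were nonzero somewhere, the zeros of \<phi> and of \<psi> would be two finite
  sets covering an infinite field. This turns generic identities along a line into identities at
  each of its points.\<close>

lemma poly_fun_eq_0:
  fixes \<phi> \<psi> :: "'a::alg_closed_field \<Rightarrow> 'a"
  assumes "\<phi> \<in> poly_fun" "\<psi> \<in> poly_fun" "\<psi> t \<noteq> 0" "\<And>s. \<psi> s \<noteq> 0 \<Longrightarrow> \<phi> s = 0"
  shows "\<phi> s = 0"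
proof (rule ccontr)
  assume "\<phi> s \<noteq> 0"
  then have "finite ({s. \<phi> s = 0} \<union> {s. \<psi> s = 0})"
    using assms poly_fun_nonzero_finite_zeros by blast
  moreover have "{s. \<phi> s = 0} \<union> {s. \<psi> s = 0} = UNIV"
    using assms(4) by blast
  ultimately show False
    using infinite_UNIV_alg_closed by metis
qed

text \<open>The nesting makes the third coordinate the outermost variable, so that induction over
  \<open>pCons\<close> splits off one factor of it at a time.\<close>

definition poly_fun3 :: "('a::comm_ring_1 \<times> 'a \<times> 'a \<Rightarrow> 'a) set" where
  "poly_fun3 = range (\<lambda>R (x, y, z). poly (poly (poly R [:[:z:]:]) [:y:]) x)"

lemma poly_fun3I:
  "(\<And>x y z. f (x, y, z) = poly (poly (poly R [:[:z:]:]) [:y:]) x) \<Longrightarrow> f \<in> poly_fun3"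
  unfolding poly_fun3_def by (intro image_eqI[of _ _ R]) (auto simp: fun_eq_iff)

lemma poly_fun3_subalgebra: "function_subalgebra (poly_fun3 :: ('a::comm_ring_1 \<times> 'a \<times> 'a \<Rightarrow> 'a) set)"
  unfolding function_subalgebra_def
proof (intro conjI allI ballI)
  show "(\<lambda>_. c) \<in> poly_fun3" for c :: 'a
    by (rule poly_fun3I[of _ "[:[:[:c:]:]:]"]) simp
next
  fix f g :: "'a \<times> 'a \<times> 'a \<Rightarrow> 'a"
  assume "f \<in> poly_fun3" "g \<in> poly_fun3"
  then obtain R S where "\<And>x y z. f (x, y, z) = poly (poly (poly R [:[:z:]:]) [:y:]) x"
    "\<And>x y z. g (x, y, z) = poly (poly (poly S [:[:z:]:]) [:y:]) x"
    unfolding poly_fun3_def by auto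
  then show "(\<lambda>x. f x + g x) \<in> poly_fun3" "(\<lambda>x. f x * g x) \<in> poly_fun3"
    by (auto intro: poly_fun3I[of _ "R + S"] poly_fun3I[of _ "R * S"])
qed

lemma poly_fun3_coords:
  "(\<lambda>v. fst v) \<in> poly_fun3" "(\<lambda>v. fst (snd v)) \<in> poly_fun3" "(\<lambda>v. snd (snd v)) \<in> poly_fun3"
  by (rule poly_fun3I[of _ "[:[:[:0, 1:]:]:]"], simp)
     (rule poly_fun3I[of _ "[:[:0, 1:]:]"], simp, rule poly_fun3I[of _ "[:0, 1:]"], simp)

lemma subalgebra_comp_poly_fun3:
  assumes "function_subalgebra H" "\<phi> \<in> poly_fun3" "f \<in> H" "g \<in> H" "h \<in> H"
  shows "(\<lambda>b. \<phi> (f b, g b, h b)) \<in> H"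
  using assms subalgebra_poly3[OF assms(1,3-5)] unfolding poly_fun3_def by auto

text \<open>Induction on the set of variables: with all variables but one fixed, a polynomial with
  infinitely many roots remains, so each of its coefficients vanishes at every choice of the fixed
  variables.\<close>

lemma coeffs_zero_if_eval_zero:
  fixes f :: "('i \<Rightarrow> nat) \<Rightarrow> 'a::alg_closed_field"
  assumes "finite I" "finite {e. f e \<noteq> 0}" "\<And>e i. f e \<noteq> 0 \<Longrightarrow> i \<notin> I \<Longrightarrow> e i = 0"
    and "\<And>x. (\<Sum>e\<in>{e. f e \<noteq> 0}. f e * (\<Prod>i\<in>I. x i ^ e i)) = 0"
  shows "f e = 0"
  using assms
proof (induction I arbitrary: f e rule: finite_induct)
  case empty
  show ?case
  proof (rule ccontr)
    assume ne: "f e \<noteq> 0"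
    have "e' = (\<lambda>_. 0)" if "f e' \<noteq> 0" for e'
      using empty.prems(2)[OF that] by auto
    then have "{e. f e \<noteq> 0} = {e}"
      using ne by auto
    with empty.prems(3)[of undefined] ne show False by simp
  qed
next
  case (insert i J)
  define S where "S = {e. f e \<noteq> 0}"
  have finS: "finite S" using insert.prems(1) by (simp add: S_def)
  \<comment> \<open>\<open>g d\<close> collects the coefficient of \<open>x i ^ d\<close> as a
    polynomial in the other variables; the value 0 for \<open>e i \<noteq> 0\<close> secures the
    support condition of the induction hypothesis.\<close>
  define g where "g d e = (if e i = 0 then f (e(i := d)) else 0)" for d e
  have g_ne: "{e. g d e \<noteq> 0} = (\<lambda>e. e(i := 0)) ` {e\<in>S. e i = d}" for d
  proof (intro equalityI subsetI)
    fix e assume "e \<in> {e. g d e \<noteq> 0}"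
    then have "e i = 0" "f (e(i := d)) \<noteq> 0" by (auto simp: g_def split: if_splits)
    then show "e \<in> (\<lambda>e. e(i := 0)) ` {e\<in>S. e i = d}"
      by (intro image_eqI[of _ _ "e(i := d)"]) (auto simp: S_def)
  qed (auto simp: g_def S_def)
  have inj: "inj_on (\<lambda>e. e(i := 0)) {e\<in>S. e i = d}" for d
    by (rule inj_onI) (metis (mono_tags, lifting) fun_upd_triv fun_upd_upd mem_Collect_eq)
  have "g d e = 0" for d e
  proof (rule insert.IH)
    show "finite {e. g d e \<noteq> 0}" unfolding g_ne using finS by auto
  next
    fix e j assume "g d e \<noteq> 0" "j \<notin> J"
    then have "f (e(i := d)) \<noteq> 0" "e i = 0"
      by (auto simp: g_def split: if_splits)
    then show "e j = 0"
      using insert.prems(2)[of "e(i := d)" j] \<open>j \<notin> J\<close> by (cases "j = i") (auto simp del: fun_upd_apply simp: fun_upd_other)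
  next
    fix x :: "'i \<Rightarrow> 'a"
    define q where "q = (\<Sum>e\<in>S. monom (f e * (\<Prod>j\<in>J. x j ^ e j)) (e i))"
    have "poly q t = 0" for t
    proof -
      have "(\<Prod>j\<in>J. (x(i := t)) j ^ e j) = (\<Prod>j\<in>J. x j ^ e j)" for e
        using insert.hyps by (intro prod.cong) auto
      then have "(\<Prod>j\<in>insert i J. (x(i := t)) j ^ e j) = t ^ e i * (\<Prod>j\<in>J. x j ^ e j)" for e
        using insert.hyps by simp
      then show ?thesis
        using insert.prems(3)[of "x(i := t)"]
        by (simp add: q_def S_def poly_sum poly_monom mult_ac)
    qed
    then have "UNIV \<subseteq> {t. poly q t = 0}" by auto
    then have "q = 0"
      using infinite_UNIV_alg_closed poly_roots_finite[of q] finite_subset by blast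
    then have "0 = coeff q d" by simp
    also have "\<dots> = (\<Sum>e\<in>S. if e i = d then f e * (\<Prod>j\<in>J. x j ^ e j) else 0)"
      unfolding q_def coeff_sum by (intro sum.cong) auto
    also have "\<dots> = (\<Sum>e\<in>{e\<in>S. e i = d}. f e * (\<Prod>j\<in>J. x j ^ e j))"
      using finS by (simp add: sum.inter_filter)
    also have "\<dots> = (\<Sum>e\<in>{e. g d e \<noteq> 0}. g d e * (\<Prod>j\<in>J. x j ^ e j))"
      unfolding g_ne sum.reindex[OF inj]
    proof (intro sum.cong refl)
      fix e assume "e \<in> {e \<in> S. e i = d}"
      moreover have "(\<Prod>j\<in>J. x j ^ e j) = (\<Prod>j\<in>J. x j ^ (e(i := 0)) j)"
        using insert.hyps by (intro prod.cong) auto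
      ultimately show "f e * (\<Prod>j\<in>J. x j ^ e j) =
          ((\<lambda>e. g d e * (\<Prod>j\<in>J. x j ^ e j)) \<circ> (\<lambda>e. e(i := 0))) e"
        by (auto simp: g_def)
    qed
    finally show "(\<Sum>e\<in>{e. g d e \<noteq> 0}. g d e * (\<Prod>j\<in>J. x j ^ e j)) = 0" by simp
  qed
  from this[of "e i" "e(i := 0)"] show ?case
    by (simp add: g_def)
qed

section \<open>Multilinear maps into three-dimensional space\<close>

definition multilinear_upto :: "nat \<Rightarrow> ((nat \<Rightarrow> 'i \<Rightarrow> 'a::comm_ring_1) \<Rightarrow> 'j \<Rightarrow> 'a) \<Rightarrow> bool" where
  "multilinear_upto m F \<longleftrightarrow>
     (\<forall>k<m. \<forall>x p q s t j. F (x(k := \<lambda>i. s * p i + t * q i)) j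
        = s * F (x(k := p)) j + t * F (x(k := q)) j) \<and>
     (\<forall>x y. (\<forall>i<m. x i = y i) \<longrightarrow> F x = F y)"

lemma multilinear_upto_line:
  assumes F: "multilinear_upto m F" and "n \<le> m"
  shows "(\<lambda>s. F (\<lambda>i. if i < n then \<lambda>k. (1 - s) * a i k + s * b i k else x i) j) \<in> poly_fun"
  using \<open>n \<le> m\<close>
proof (induction n arbitrary: x)
  case 0
  then show ?case by (simp add: poly_fun_intros)
next
  case (Suc n)
  define l where "l s i = (\<lambda>k. (1 - s) * a i k + s * b i k)" for s i
  have upd: "(\<lambda>i. if i < n then l s i else x i)(n := u) = (\<lambda>i. if i < n then l s i else (x(n := u)) i)"
    for s u by auto
  have "(\<lambda>i. if i < Suc n then l s i else x i) =
      (\<lambda>i. if i < n then l s i else x i)(n := \<lambda>k. (1 - s) * a n k + s * b n k)" for s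
    by (auto simp: fun_eq_iff l_def less_Suc_eq)
  then have "F (\<lambda>i. if i < Suc n then l s i else x i) j =
      (1 - s) * F (\<lambda>i. if i < n then l s i else (x(n := a n)) i) j
      + s * F (\<lambda>i. if i < n then l s i else (x(n := b n)) i) j" for s
    using F Suc.prems unfolding multilinear_upto_def upd[symmetric] by auto
  moreover have "(\<lambda>s. F (\<lambda>i. if i < n then l s i else y i) j) \<in> poly_fun" for y
    unfolding l_def using Suc.IH[of y] Suc.prems by simp
  ultimately show ?case
    unfolding l_def[symmetric] by (simp add: poly_fun_intros del: fun_upd_apply)
qed

lemma multilinear_upto_line':
  assumes F: "multilinear_upto m F"
  shows "(\<lambda>s. F (\<lambda>i k. (1 - s) * a i k + s * b i k) j) \<in> poly_fun"
proof -
  have "F (\<lambda>i. if i < m then \<lambda>k. (1 - s) * a i k + s * b i k else a i) =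
      F (\<lambda>i k. (1 - s) * a i k + s * b i k)" for s
    using F unfolding multilinear_upto_def by auto
  then show ?thesis
    using multilinear_upto_line[OF F order_refl, of a b a j] by simp
qed

text \<open>Move from a generic point of the line through \<open>a\<close> and \<open>b\<close> to \<open>a\<close>, one argument at a time:
  generically all intermediate values are nonzero, so if consecutive ones were always proportional,
  then so would be the values at the two ends.\<close>

lemma multilinear_upto_one_argument:
  fixes F :: "(nat \<Rightarrow> 'i \<Rightarrow> 'a::alg_closed_field) \<Rightarrow> 'j \<Rightarrow> 'a"
  assumes F: "multilinear_upto m F" and ne: "F a i * F b j \<noteq> F a j * F b i"
  obtains k x p q where "k < m" "F (x(k := p)) i * F (x(k := q)) j \<noteq> F (x(k := p)) j * F (x(k := q)) i"
proof (rule ccontr)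
  note witness = that
  assume neg: "\<not> thesis"
  have prp: "F (x(k := p)) i * F (x(k := q)) j = F (x(k := p)) j * F (x(k := q)) i" if "k < m" for x k p q
    using neg that witness by blast
  \<comment> \<open>Stated for arbitrary coordinates because it needs
    \<open>F a j \<noteq> 0\<close>; if that fails, \<open>F a i\<close> is nonzero and the roles
    are swapped.\<close>
  have main: False if ne: "F a i * F b j \<noteq> F a j * F b i" and aj: "F a j \<noteq> 0"
    and prp: "\<And>x k p q. k < m \<Longrightarrow>
      F (x(k := p)) i * F (x(k := q)) j = F (x(k := p)) j * F (x(k := q)) i" for i j
  proof -
    define l where "l s i = (\<lambda>k. (1 - s) * a i k + s * b i k)" for s i
    \<comment> \<open>Neighbours in the chain from \<open>a\<close> to the point \<open>l s\<close>
      of the line differ in one argument only.\<close>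
    define mix where "mix n s = (\<lambda>i. if i < n then l s i else a i)" for n s
    \<comment> \<open>The minor of the two ends of the chain; at \<open>s = 1\<close> it is the
      nonzero minor of \<open>a\<close> and \<open>b\<close>.\<close>
    define \<mu> where "\<mu> s = F a i * F (l s) j - F a j * F (l s) i" for s
    have l0: "l 0 = a" and l1: "l 1 = b"
      by (auto simp: l_def fun_eq_iff)
    have "finite {s. F (mix n s) j = 0}" if "n \<le> m" for n
    proof (rule poly_fun_nonzero_finite_zeros)
      show "(\<lambda>s. F (mix n s) j) \<in> poly_fun"
        unfolding mix_def l_def by (rule multilinear_upto_line[OF F that, of a b a j])
      show "F (mix n 0) j \<noteq> 0"
      proof -
        have "mix n 0 = a" by (auto simp: mix_def l0)
        then show ?thesis using aj by simp
      qed
    qed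
    moreover have "finite {s. \<mu> s = 0}"
    proof (rule poly_fun_nonzero_finite_zeros)
      show "\<mu> \<in> poly_fun"
        using multilinear_upto_line'[OF F, of a b] unfolding \<mu>_def l_def
        by (intro subalgebra_diff subalgebra_mult subalgebra_const poly_fun_subalgebra)
      show "\<mu> 1 \<noteq> 0" using ne by (simp add: \<mu>_def l1)
    qed
    ultimately have "finite ({s. \<mu> s = 0} \<union> (\<Union>n\<in>{..m}. {s. F (mix n s) j = 0}))"
      by auto
    then obtain s where s: "\<mu> s \<noteq> 0" "\<And>n. n \<le> m \<Longrightarrow> F (mix n s) j \<noteq> 0"
      using ex_new_if_finite[OF infinite_UNIV_alg_closed] by blast
    have "F (mix n s) i * F a j = F a i * F (mix n s) j" if "n \<le> m" for n
      using that
    proof (induction n)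
      case 0
      then show ?case by (simp add: mix_def)
    next
      case (Suc n)
      have "mix (Suc n) s = (mix n s)(n := l s n)" "mix n s = (mix n s)(n := a n)"
        by (auto simp: mix_def less_Suc_eq)
      then have step: "F (mix (Suc n) s) i * F (mix n s) j = F (mix (Suc n) s) j * F (mix n s) i"
        using prp[of n "mix n s" "l s n" "a n"] Suc.prems by simp
      have IH: "F (mix n s) i * F a j = F a i * F (mix n s) j"
        using Suc by simp
      \<comment> \<open>Proportionality passes only through a nonzero middle value, so the factor
        \<open>F (mix n s) j\<close> is carried along and cancelled at the end.\<close>
      have "F (mix n s) j * (F (mix (Suc n) s) i * F a j) = (F (mix (Suc n) s) i * F (mix n s) j) * F a j"
        by (simp only: mult_ac)
      also have "\<dots> = F (mix (Suc n) s) j * (F (mix n s) i * F a j)"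
        by (simp only: step mult.assoc)
      also have "\<dots> = F (mix n s) j * (F a i * F (mix (Suc n) s) j)"
        unfolding IH by (simp only: mult_ac)
      finally have "F (mix n s) j * (F (mix (Suc n) s) i * F a j) = F (mix n s) j * (F a i * F (mix (Suc n) s) j)" .
      then show ?case using s(2)[of n] Suc.prems by simp
    qed
    from this[of m] have "F (mix m s) i * F a j = F a i * F (mix m s) j" by simp
    moreover have "F (mix m s) = F (l s)"
      using F unfolding multilinear_upto_def mix_def by auto
    ultimately show False using s(1) by (simp add: \<mu>_def mult.commute)
  qed
  show False
  proof (cases "F a j = 0")
    case False
    then show ?thesis using main[OF ne] prp by blast
  next
    case True
    then have "F a i \<noteq> 0" using ne by auto
    moreover have "F a j * F b i \<noteq> F a i * F b j" using ne by simp
    ultimately show ?thesis using main[of j i] prp by metis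
  qed
qed

text \<open>The image contains a plane \<open>ell = 0\<close>, hence \<open>ell\<close> divides every polynomial vanishing on the image;
  since \<open>ell\<close> does not vanish on the image, it can be cancelled, so that such a polynomial
  is infinitely divisible by \<open>ell\<close>.\<close>

lemma multilinear_upto_dense:
  fixes F :: "(nat \<Rightarrow> 'i \<Rightarrow> 'a::alg_closed_field) \<Rightarrow> nat \<Rightarrow> 'a"
  assumes F: "multilinear_upto m F"
    and span: "\<And>n0 n1 n2. (\<And>x. n0 * F x 0 + n1 * F x 1 + n2 * F x 2 = 0) \<Longrightarrow> n0 = 0 \<and> n1 = 0 \<and> n2 = 0"
    and \<phi>: "\<phi> \<in> poly_fun3" and van: "\<And>x. \<phi> (F x 0, F x 1, F x 2) = 0"
  shows "\<phi> v = 0"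
proof -
  \<comment> \<open>If no such \<open>a\<close>, or then no such \<open>b\<close>, existed, a
    nonzero linear functional would vanish on the image: the first coordinate, or the minor with
    \<open>F a\<close>.\<close>
  obtain a where a: "F a 0 \<noteq> 0"
    using span[of 1 0 0] by auto
  obtain b where "F a 1 * F b 0 - F a 0 * F b 1 \<noteq> 0"
    using span[of "F a 1" "- F a 0" 0] a by auto
  then have "F a 0 * F b 1 \<noteq> F a 1 * F b 0" by simp
  from multilinear_upto_one_argument[OF F this]
  obtain k x p q where k: "k < m"
    and "F (x(k := p)) 0 * F (x(k := q)) 1 \<noteq> F (x(k := p)) 1 * F (x(k := q)) 0" by metis
  define U V where "U = F (x(k := p))" and "V = F (x(k := q))"
  \<comment> \<open>The cross product of \<open>U\<close> and \<open>V\<close>, normal to the plane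
    they span; its last entry is the nonzero minor just found.\<close>
  define n0 n1 n2 where "n0 = U 1 * V 2 - U 2 * V 1" and "n1 = U 2 * V 0 - U 0 * V 2"
    and "n2 = U 0 * V 1 - U 1 * V 0"
  have n2: "n2 \<noteq> 0"
    using \<open>F (x(k := p)) 0 * _ \<noteq> _\<close> by (simp add: n2_def U_def V_def)
  define ell where "ell y = n0 * F y 0 + n1 * F y 1 + n2 * F y 2" for y
  obtain w where w: "ell w \<noteq> 0"
    using span[of n0 n1 n2] n2 unfolding ell_def by auto
  have plane: "\<exists>y. F y 0 = X \<and> F y 1 = Y \<and> ell y = 0" for X Y
  proof -
    \<comment> \<open>Cramer's rule for giving \<open>s * U + t * V\<close> the first two
      coordinates \<open>X\<close> and \<open>Y\<close>.\<close>
    define s t where "s = (X * V 1 - Y * V 0) / n2" and "t = (U 0 * Y - U 1 * X) / n2"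
    define y where "y = x(k := \<lambda>i. s * p i + t * q i)"
    have y: "F y j = s * U j + t * V j" for j
      using F k unfolding multilinear_upto_def y_def U_def V_def by blast
    have "n2 * F y 0 = n2 * X" "n2 * F y 1 = n2 * Y"
      using n2 unfolding y s_def t_def
      by (simp_all add: field_simps) (simp_all add: n2_def algebra_simps)
    then have "F y 0 = X" "F y 1 = Y" using n2 by simp_all
    moreover have "ell y = 0"
      unfolding ell_def y n0_def n1_def n2_def by (simp add: algebra_simps)
    ultimately show ?thesis by blast
  qed
  \<comment> \<open>\<open>R\<close> is a polynomial in the first two coordinates and
    \<open>ell\<close>. Its constant term in \<open>ell\<close> vanishes by \<open>plane\<close>;
    the cofactor \<rho> of \<open>ell\<close> then vanishes wherever \<open>ell\<close> does not,
    hence, along the line to \<open>w\<close>, for all \<open>y\<close>.\<close>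
  have eval: "\<forall>X Y Z. poly (poly (poly R [:[:Z:]:]) [:Y:]) X = 0"
    if "\<And>y. poly (poly (poly R [:[:ell y:]:]) [:F y 1:]) (F y 0) = 0" for R :: "'a poly poly poly"
    using that
  proof (induction R)
    case 0
    then show ?case by simp
  next
    case (pCons R0 R)
    have R0: "poly (poly R0 [:Y:]) X = 0" for X Y
    proof -
      obtain y where "F y 0 = X" "F y 1 = Y" "ell y = 0" using plane by blast
      then show ?thesis using pCons.prems[of y] by simp
    qed
    define \<rho> where "\<rho> y = poly (poly (poly R [:[:ell y:]:]) [:F y 1:]) (F y 0)" for y
    have "\<rho> y = 0" for y
    proof -
      define L where "L s = (\<lambda>i k. (1 - s) * y i k + s * w i k)" for s
      have L0: "L 0 = y" and L1: "L 1 = w" by (auto simp: L_def)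
      have Lj: "(\<lambda>s. F (L s) j) \<in> poly_fun" for j
        unfolding L_def by (rule multilinear_upto_line'[OF F])
      have Lell: "(\<lambda>s. ell (L s)) \<in> poly_fun"
        unfolding ell_def by (intro poly_fun_intros Lj)
      have "\<rho> (L 0) = 0"
      proof (rule poly_fun_eq_0[of "\<lambda>s. \<rho> (L s)" "\<lambda>s. ell (L s)"])
        show "(\<lambda>s. \<rho> (L s)) \<in> poly_fun"
          unfolding \<rho>_def by (rule subalgebra_poly3[OF poly_fun_subalgebra Lj Lj Lell])
        show "ell (L 1) \<noteq> 0" by (simp add: L1 w)
        show "\<rho> (L s) = 0" if "ell (L s) \<noteq> 0" for s
          using pCons.prems[of "L s"] R0 that by (simp add: \<rho>_def)
      qed (rule Lell)
      then show ?thesis by (simp add: L0)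
    qed
    then have "\<forall>X Y Z. poly (poly (poly R [:[:Z:]:]) [:Y:]) X = 0"
      by (intro pCons.IH) (simp add: \<rho>_def)
    then show ?case using R0 by simp
  qed
  \<comment> \<open>\<phi> in the new coordinates, where \<open>ell\<close> replaces the third one;
    this is possible because \<open>n2 \<noteq> 0\<close>.\<close>
  define \<Phi> where "\<Phi> = (\<lambda>u. \<phi> (fst u, fst (snd u), inverse n2 * (snd (snd u) - n0 * fst u - n1 * fst (snd u))))"
  have "\<Phi> \<in> poly_fun3"
    unfolding \<Phi>_def
    by (rule subalgebra_comp_poly_fun3[OF poly_fun3_subalgebra \<phi>])
       (intro subalgebra_mult subalgebra_diff subalgebra_const poly_fun3_subalgebra poly_fun3_coords)+
  then obtain R where R: "\<And>X Y Z. \<Phi> (X, Y, Z) = poly (poly (poly R [:[:Z:]:]) [:Y:]) X"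
    unfolding poly_fun3_def by auto
  have "\<Phi> (F y 0, F y 1, ell y) = 0" for y
    using van[of y] n2 by (simp add: \<Phi>_def ell_def mult.assoc[symmetric])
  then have 0: "\<Phi> (X, Y, Z) = 0" for X Y Z
    using eval[of R] by (simp add: R)
  obtain X Y Z where v: "v = (X, Y, Z)" by (cases v) auto
  show ?thesis
    using 0[of X Y "n0 * X + n1 * Y + n2 * Z"] n2 by (simp add: \<Phi>_def v mult.assoc[symmetric])
qed

section \<open>Density of the diagonalizable matrices\<close>

lemma less_3_cases: "i < 3 \<Longrightarrow> (i = 0 \<Longrightarrow> P) \<Longrightarrow> (i = 1 \<Longrightarrow> P) \<Longrightarrow> (i = 2 \<Longrightarrow> P) \<Longrightarrow> P" for i :: nat
  by linarith

lemma mat_eq_3: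
  assumes "A \<in> carrier_mat 3 3" "B \<in> carrier_mat 3 3"
    and "\<And>i. i < 3 \<Longrightarrow> A $$ (i, 0) = B $$ (i, 0)" "\<And>i. i < 3 \<Longrightarrow> A $$ (i, 1) = B $$ (i, 1)"
      "\<And>i. i < 3 \<Longrightarrow> A $$ (i, 2) = B $$ (i, 2)"
  shows "A = B"
proof (rule eq_matI)
  fix i j assume "i < dim_row B" "j < dim_col B"
  then have "i < 3" "j < 3" using assms by auto
  then show "A $$ (i, j) = B $$ (i, j)"
    using assms(3-5) by (elim less_3_cases[of j]) auto
qed (use assms in auto)

lemma mult_carrier_mat_3 [simp]:
  "A \<in> carrier_mat 3 3 \<Longrightarrow> B \<in> carrier_mat 3 3 \<Longrightarrow> A * B \<in> carrier_mat 3 3"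
  by (rule mult_carrier_mat)

lemma index_mult_mat_3:
  assumes "A \<in> carrier_mat 3 3" "B \<in> carrier_mat 3 3" "i < 3" "j < 3"
  shows "(A * B) $$ (i, j) = A $$ (i, 0) * B $$ (0, j) + A $$ (i, 1) * B $$ (1, j) + A $$ (i, 2) * B $$ (2, j)"
proof -
  have "{0..<3} = {0, 1, 2 :: nat}" by auto
  then show ?thesis using assms by (simp add: scalar_prod_def add.assoc)
qed

lemma subalgebra_mat_mult:
  assumes H: "function_subalgebra H"
    and car: "\<And>x. M x \<in> carrier_mat n n" "\<And>x. N x \<in> carrier_mat n n"
    and ent: "\<And>i j. i < n \<Longrightarrow> j < n \<Longrightarrow> (\<lambda>x. M x $$ (i, j)) \<in> H" "\<And>i j. i < n \<Longrightarrow> j < n \<Longrightarrow> (\<lambda>x. N x $$ (i, j)) \<in> H"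
    and "i < n" "j < n"
  shows "(\<lambda>x. (M x * N x) $$ (i, j)) \<in> H"
proof -
  have "(M x * N x) $$ (i, j) = (\<Sum>k\<in>{0..<n}. M x $$ (i, k) * N x $$ (k, j))" for x
    using car[of x] assms(6,7) by (auto simp: scalar_prod_def intro!: sum.cong)
  then have "(\<lambda>x. (M x * N x) $$ (i, j)) = (\<lambda>x. \<Sum>k\<in>{0..<n}. M x $$ (i, k) * N x $$ (k, j))"
    by blast
  also have "\<dots> \<in> H"
    using ent assms(6,7) by (intro subalgebra_sum[OF H] subalgebra_mult[OF H]) auto
  finally show ?thesis .
qed

definition diag3 :: "'a::zero \<times> 'a \<times> 'a \<Rightarrow> 'a mat" where
  "diag3 = (\<lambda>(x, y, z). mat 3 3 (\<lambda>(i, j). if i = j then (if i = 0 then x else if i = 1 then y else z) else 0))"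

lemma diag3_carrier [simp]: "diag3 v \<in> carrier_mat 3 3"
  by (cases v) (simp add: diag3_def)

text \<open>The companion matrix of the monic cubic with roots \<open>a\<close>, \<open>b\<close>, \<open>c\<close>.\<close>

definition companion3 :: "'a::comm_ring_1 \<Rightarrow> 'a \<Rightarrow> 'a \<Rightarrow> 'a mat" where
  "companion3 a b c = mat 3 3 (\<lambda>(i, j).
     if j = 0 then (if i = 1 then 1 else 0)
     else if j = 1 then (if i = 2 then 1 else 0)
     else if i = 0 then a * b * c else if i = 1 then - (a * b + b * c + c * a) else a + b + c)"

lemma companion3_carrier [simp]: "companion3 a b c \<in> carrier_mat 3 3"
  by (simp add: companion3_def)

text \<open>The columns of \<open>W\<close> are the coefficients of the polynomials \<open>(t - b) (t - c)\<close> etc.,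
  so Lagrange interpolation gives the inverse matrix.\<close>

lemma companion3_diagonalizable:
  fixes a b c :: "'a::field"
  assumes "a \<noteq> b" "a \<noteq> c" "b \<noteq> c"
  obtains W W' where "W \<in> carrier_mat 3 3" "W' \<in> carrier_mat 3 3" "W * W' = 1\<^sub>m 3"
    "companion3 a b c = W * diag3 (a, b, c) * W'"
proof -
  define W where "W = mat 3 3 (\<lambda>(i, j).
    if j = 0 then (if i = 0 then b * c else if i = 1 then - (b + c) else 1)
    else if j = 1 then (if i = 0 then a * c else if i = 1 then - (a + c) else 1)
    else (if i = 0 then a * b else if i = 1 then - (a + b) else 1))"
  define W' where "W' = mat 3 3 (\<lambda>(i, j).
    if i = 0 then a ^ j / ((a - b) * (a - c))
    else if i = 1 then b ^ j / ((b - a) * (b - c))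
    else c ^ j / ((c - a) * (c - b)))"
  have [simp]: "W \<in> carrier_mat 3 3" "W' \<in> carrier_mat 3 3"
    by (auto simp: W_def W'_def)
  have ne: "a - b \<noteq> 0" "a - c \<noteq> 0" "b - c \<noteq> 0" "b - a \<noteq> 0" "c - a \<noteq> 0" "c - b \<noteq> 0"
    using assms by auto
  have "W' * W = 1\<^sub>m 3"
    using ne by (intro mat_eq_3; (elim less_3_cases)?)
      (simp_all add: index_mult_mat_3 del: index_mult_mat(1),
       simp_all add: W_def W'_def add_divide_distrib[symmetric] diff_divide_distrib[symmetric] divide_eq_1_iff,
       simp_all add: algebra_simps power2_eq_square)
  then have WW': "W * W' = 1\<^sub>m 3"
    by (rule mat_mult_left_right_inverse[rotated 2]) auto
  \<comment> \<open>The companion matrix is multiplication by \<open>t\<close> modulo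
    \<open>(t - a) (t - b) (t - c)\<close> in the basis \<open>1, t, t^2\<close>, so
    \<open>(t - b) (t - c)\<close> is an eigenvector for \<open>a\<close>, and similarly for the
    other columns.\<close>
  have "companion3 a b c * W = W * diag3 (a, b, c)"
    by (intro mat_eq_3; (elim less_3_cases)?)
      (simp_all add: index_mult_mat_3 del: index_mult_mat(1),
       simp_all add: W_def companion3_def diag3_def algebra_simps)
  then have "W * diag3 (a, b, c) * W' = companion3 a b c * W * W'"
    by simp
  also have "\<dots> = companion3 a b c"
    by (subst assoc_mult_mat[of _ 3 3 _ 3 _ 3])
       (auto simp: WW' right_mult_one_mat[OF companion3_carrier])
  finally show ?thesis using that[of W W'] WW' by simp
qed

lemma exists_cubic_roots:
  fixes e1 e2 e3 :: "'a::alg_closed_field"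
  obtains a b c where "a + b + c = e1" "a * b + b * c + c * a = e2" "a * b * c = e3"
proof -
  obtain a where "poly [:- e3, e2, - e1, 1:] a = 0"
    using alg_closed_imp_poly_has_root[of "[:- e3, e2, - e1, 1:]"] by auto
  then have a: "e3 = a * (e2 + a * (a - e1))" by (simp add: algebra_simps)
  \<comment> \<open>The quadratic is the quotient of the cubic by \<open>t - a\<close>; the third
    root is then forced by the sum \<open>e1\<close>.\<close>
  obtain b where "poly [:a * a - e1 * a + e2, a - e1, 1:] b = 0"
    using alg_closed_imp_poly_has_root[of "[:a * a - e1 * a + e2, a - e1, 1:]"] by auto
  then have b: "e2 = e1 * a - a * a - b * (a - e1 + b)" by (simp add: algebra_simps)
  show ?thesis
    by (rule that[of a b "e1 - a - b"]) (simp_all add: a, simp_all add: b algebra_simps)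
qed

text \<open>With \<open>S\<close> the matrix with columns \<open>e, A e, A\<^sup>2 e\<close>, where \<open>e\<close> is the first basis vector,
  \<open>A\<close> is conjugate to a companion matrix by \<open>S\<close> as soon as \<open>S\<close> is invertible.\<close>

lemma conjugate_companion3:
  fixes A :: "'a::alg_closed_field mat"
  assumes A: "A \<in> carrier_mat 3 3"
    and ne: "A $$ (1, 0) * (A * A) $$ (2, 0) - A $$ (2, 0) * (A * A) $$ (1, 0) \<noteq> 0"
  obtains S S' a b c where "S \<in> carrier_mat 3 3" "S' \<in> carrier_mat 3 3" "S * S' = 1\<^sub>m 3"
    "A = S * companion3 a b c * S'"
proof -
  define x p r y q t where "x = A $$ (0, 0)" and "p = A $$ (1, 0)" and "r = A $$ (2, 0)"
    and "y = (A * A) $$ (0, 0)" and "q = (A * A) $$ (1, 0)" and "t = (A * A) $$ (2, 0)"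
  define d where "d = p * t - r * q"
  define S where "S = mat 3 3 (\<lambda>(i, j).
    if j = 0 then (if i = 0 then 1 else 0) else if j = 1 then A $$ (i, 0) else (A * A) $$ (i, 0))"
  \<comment> \<open>The adjugate of \<open>S\<close> divided by its determinant
    \<open>d\<close>.\<close>
  define S' where "S' = mat 3 3 (\<lambda>(i, j).
    if i = 0 then (if j = 0 then 1 else if j = 1 then (y * r - x * t) / d else (x * q - y * p) / d)
    else if i = 1 then (if j = 0 then 0 else if j = 1 then t / d else - (q / d))
    else (if j = 0 then 0 else if j = 1 then - (r / d) else p / d))"
  have d: "d \<noteq> 0" using ne by (simp add: d_def p_def q_def r_def t_def)
  have S[simp]: "S \<in> carrier_mat 3 3" "S' \<in> carrier_mat 3 3"
    by (auto simp: S_def S'_def)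
  have ents: "A $$ (0, 0) = x" "A $$ (Suc 0, 0) = p" "A $$ (2, 0) = r"
    "(A * A) $$ (0, 0) = y" "(A * A) $$ (Suc 0, 0) = q" "(A * A) $$ (2, 0) = t"
    by (simp_all add: x_def p_def r_def y_def q_def t_def)
  have SS': "S * S' = 1\<^sub>m 3"
    using d by (intro mat_eq_3; (elim less_3_cases)?)
      (simp_all add: index_mult_mat_3 del: index_mult_mat(1),
       simp_all add: S_def S'_def ents field_simps del: index_mult_mat(1),
       simp_all add: d_def algebra_simps)
  then have S'S: "S' * S = 1\<^sub>m 3"
    by (rule mat_mult_left_right_inverse[rotated 2]) auto
  define C where "C = S' * (A * S)"
  have C[simp]: "C \<in> carrier_mat 3 3" using A by (auto simp: C_def intro!: mult_carrier_mat)
  have AS: "A * S \<in> carrier_mat 3 3" using A by (auto intro!: mult_carrier_mat)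
  \<comment> \<open>\<open>A\<close> sends \<open>e\<close> to \<open>A e\<close> and
    \<open>A e\<close> to \<open>A (A e)\<close>, so the first two columns of \<open>C\<close> are
    automatically those of a companion matrix; \<open>a\<close>, \<open>b\<close>, \<open>c\<close>
    are chosen to match the last one.\<close>
  have AS0: "(A * S) $$ (i, 0) = S $$ (i, 1)" "(A * S) $$ (i, 1) = S $$ (i, 2)" if "i < 3" for i
    using that A by (simp_all add: index_mult_mat_3 del: index_mult_mat(1),
      simp_all add: S_def index_mult_mat_3 del: index_mult_mat(1))
  have C0: "C $$ (i, 0) = (S' * S) $$ (i, 1)" "C $$ (i, 1) = (S' * S) $$ (i, 2)" if "i < 3" for i
    using that unfolding C_def by (simp_all add: index_mult_mat_3[of S'] AS AS0 AS0[unfolded One_nat_def] del: index_mult_mat(1))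
  obtain a b c where abc: "a + b + c = C $$ (2, 2)" "a * b + b * c + c * a = - C $$ (1, 2)" "a * b * c = C $$ (0, 2)"
    by (rule exists_cubic_roots)
  have "companion3 a b c = C"
    by (intro mat_eq_3; (elim less_3_cases)?)
      (simp_all only: C0 S'S, simp_all add: companion3_def abc abc[simplified])
  moreover have "S * C * S' = A"
  proof -
    have "S * C = S * S' * (A * S)"
      unfolding C_def by (rule assoc_mult_mat[symmetric, of _ 3 3 _ 3 _ 3]) (auto simp: AS)
    also have "\<dots> = A * S" by (simp add: SS' left_mult_one_mat[OF AS])
    finally have "S * C * S' = A * (S * S')"
      using assoc_mult_mat[OF A S] by simp
    then show ?thesis using A by (simp add: SS')
  qed
  ultimately show ?thesis using that[of S S' a b c] SS' by simp
qed

text \<open>Three stages: companion matrices with distinct roots are diagonalizable; deforming the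
  roots admits repeated ones; deforming \<open>A\<close> admits matrices for which the first basis
  vector is not cyclic.\<close>

lemma entry_poly_eval_zero_if_zero_on_diagonalizable:
  fixes f :: "(nat \<times> nat \<Rightarrow> nat) \<Rightarrow> 'a::alg_closed_field"
  assumes diag: "\<And>S S' v. S \<in> carrier_mat 3 3 \<Longrightarrow> S' \<in> carrier_mat 3 3 \<Longrightarrow> S * S' = 1\<^sub>m 3 \<Longrightarrow>
      entry_poly_eval 3 f (S * diag3 v * S') = 0"
    and A: "A \<in> carrier_mat 3 3"
  shows "entry_poly_eval 3 f A = 0"
proof -
  have distinct: "entry_poly_eval 3 f (S * companion3 a b c * S') = 0"
    if S: "S \<in> carrier_mat 3 3" "S' \<in> carrier_mat 3 3" "S * S' = 1\<^sub>m 3" and ne: "a \<noteq> b" "a \<noteq> c" "b \<noteq> c"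
    for S S' a b c
  proof -
    obtain W W' where W: "W \<in> carrier_mat 3 3" "W' \<in> carrier_mat 3 3" "W * W' = 1\<^sub>m 3"
      "companion3 a b c = W * diag3 (a, b, c) * W'"
      using companion3_diagonalizable[OF ne] by blast
    define D where "D = diag3 (a, b, c)"
    have D: "D \<in> carrier_mat 3 3" by (simp add: D_def)
    note asc = assoc_mult_mat[of _ 3 3 _ 3 _ 3]
    have "S * (W * D * W') * S' = S * W * D * (W' * S')"
      using S W(1,2) D by (simp add: asc)
    moreover have "S * W * (W' * S') = 1\<^sub>m 3"
    proof -
      have "S * W * (W' * S') = S * (W * W') * S'"
        using S W(1,2) by (simp add: asc)
      then show ?thesis using S W(3) by simp
    qed
    ultimately show ?thesis
      using diag[of "S * W" "W' * S'" "(a, b, c)"] S W by (simp add: D_def)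
  qed
  \<comment> \<open>At \<open>s = 1\<close> the deformed roots will be 0, 1 and \<open>d\<close>,
    hence distinct.\<close>
  obtain d :: 'a where d: "d \<noteq> 0" "d \<noteq> 1"
    using ex_new_if_finite[OF infinite_UNIV_alg_closed, of "{0, 1}"] by auto
  have conj: "entry_poly_eval 3 f (S * companion3 a b c * S') = 0"
    if S: "S \<in> carrier_mat 3 3" "S' \<in> carrier_mat 3 3" "S * S' = 1\<^sub>m 3" for S S' a b c
  proof -
    define a' b' c' where "a' s = (1 - s) * a" and "b' s = (1 - s) * b + s" and "c' s = (1 - s) * c + s * d" for s
    have pf: "a' \<in> poly_fun" "b' \<in> poly_fun" "c' \<in> poly_fun"
      unfolding a'_def b'_def c'_def by (intro poly_fun_intros)+
    define \<psi> where "\<psi> s = (a' s - b' s) * (a' s - c' s) * (b' s - c' s)" for s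
    have "entry_poly_eval 3 f (S * companion3 (a' 0) (b' 0) (c' 0) * S') = 0"
    proof (rule poly_fun_eq_0[where \<psi> = \<psi> and \<phi> = "\<lambda>s. entry_poly_eval 3 f (S * companion3 (a' s) (b' s) (c' s) * S')"])
      have "(\<lambda>s. companion3 (a' s) (b' s) (c' s) $$ (i, j)) \<in> poly_fun" if "i < 3" "j < 3" for i j
      proof -
        have "(\<lambda>s. - (a' s * b' s + b' s * c' s + c' s * a' s)) = (\<lambda>s. 0 - (a' s * b' s + b' s * c' s + c' s * a' s))"
          by simp
        also have "\<dots> \<in> poly_fun" by (intro poly_fun_intros pf)
        finally have 1: "(\<lambda>s. - (a' s * b' s + b' s * c' s + c' s * a' s)) \<in> poly_fun" .
        have 2: "(\<lambda>s. a' s * b' s * c' s) \<in> poly_fun" "(\<lambda>s. a' s + b' s + c' s) \<in> poly_fun"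
          by (intro poly_fun_intros pf)+
        show ?thesis
          using that by (elim less_3_cases) (use 1 2 in \<open>simp_all add: companion3_def poly_fun_intros\<close>)
      qed
      then show "(\<lambda>s. entry_poly_eval 3 f (S * companion3 (a' s) (b' s) (c' s) * S')) \<in> poly_fun"
        by (intro subalgebra_entry_poly_eval[OF poly_fun_subalgebra] subalgebra_mat_mult[OF poly_fun_subalgebra, where n = 3])
           (auto intro!: mult_carrier_mat S poly_fun_intros)
      show "\<psi> \<in> poly_fun"
        unfolding \<psi>_def by (intro poly_fun_intros pf)
      show "\<psi> 1 \<noteq> 0" using d by (simp add: \<psi>_def a'_def b'_def c'_def)
      show "entry_poly_eval 3 f (S * companion3 (a' s) (b' s) (c' s) * S') = 0" if "\<psi> s \<noteq> 0" for s
        using that by (intro distinct S) (auto simp: \<psi>_def)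
    qed
    then show ?thesis by (simp add: a'_def b'_def c'_def)
  qed
  \<comment> \<open>\<open>N\<close> sends each basis vector to the next, so its first basis vector
    is cyclic and \<open>\<psi> 1 = 1\<close>.\<close>
  define N :: "'a mat" where "N = mat 3 3 (\<lambda>(i, j). if i = Suc j then 1 else 0)"
  define L where "L s = mat 3 3 (\<lambda>(i, j). (1 - s) * A $$ (i, j) + s * N $$ (i, j))" for s
  have Lc: "L s \<in> carrier_mat 3 3" for s by (simp add: L_def)
  have Lp: "(\<lambda>s. L s $$ (i, j)) \<in> poly_fun" if "i < 3" "j < 3" for i j
    using that unfolding L_def by (simp add: poly_fun_intros)
  have L0: "L 0 = A" using A by (intro eq_matI) (auto simp: L_def)
  have L1: "L 1 = N" by (intro eq_matI) (auto simp: L_def N_def)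
  define \<psi> where "\<psi> s = L s $$ (1, 0) * (L s * L s) $$ (2, 0) - L s $$ (2, 0) * (L s * L s) $$ (1, 0)" for s
  have "entry_poly_eval 3 f (L 0) = 0"
  proof (rule poly_fun_eq_0[where \<psi> = \<psi> and \<phi> = "\<lambda>s. entry_poly_eval 3 f (L s)"])
    show "(\<lambda>s. entry_poly_eval 3 f (L s)) \<in> poly_fun"
      by (intro subalgebra_entry_poly_eval[OF poly_fun_subalgebra] Lp)
    have "(\<lambda>s. (L s * L s) $$ (i, j)) \<in> poly_fun" if "i < 3" "j < 3" for i j
      using that by (intro subalgebra_mat_mult[OF poly_fun_subalgebra, where n = 3] Lp Lc)
    then show "\<psi> \<in> poly_fun"
      unfolding \<psi>_def by (intro poly_fun_intros Lp) auto
    show "\<psi> 1 \<noteq> 0"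
      unfolding \<psi>_def L1 by (simp add: index_mult_mat_3 N_def del: index_mult_mat(1))
    show "entry_poly_eval 3 f (L s) = 0" if ne: "\<psi> s \<noteq> 0" for s
    proof -
      obtain S S' a b c where "S \<in> carrier_mat 3 3" "S' \<in> carrier_mat 3 3" "S * S' = 1\<^sub>m 3"
        "L s = S * companion3 a b c * S'"
        using conjugate_companion3[OF Lc ne[unfolded \<psi>_def]] by blast
      then show ?thesis using conj by simp
    qed
  qed
  then show ?thesis by (simp add: L0)
qed

section \<open>Evaluation of multilinear polynomials\<close>

lemma prod_list_mat_Cons: "prod_list_mat n (A # As) = A * prod_list_mat n As"
  by (simp add: prod_list_mat_def)

lemma prod_list_mat_carrier:
  "(\<And>A. A \<in> set As \<Longrightarrow> A \<in> carrier_mat n n) \<Longrightarrow> prod_list_mat n As \<in> carrier_mat n n"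
  by (induction As) (auto simp: prod_list_mat_Cons prod_list_mat_def[of _ "[]"] intro!: mult_carrier_mat)

text \<open>The changed factor occurs exactly once in the product, as it does in every monomial of a
  multilinear polynomial.\<close>

lemma prod_list_mat_linear:
  fixes A :: "nat \<Rightarrow> 'a::comm_ring_1 mat"
  assumes "distinct is" "k \<in> set is" and A: "\<And>i. A i \<in> carrier_mat n n"
    and P: "P \<in> carrier_mat n n" and Q: "Q \<in> carrier_mat n n"
  shows "prod_list_mat n (map (A(k := s \<cdot>\<^sub>m P + t \<cdot>\<^sub>m Q)) is) =
    s \<cdot>\<^sub>m prod_list_mat n (map (A(k := P)) is) + t \<cdot>\<^sub>m prod_list_mat n (map (A(k := Q)) is)"
  using assms(1,2)
proof (induction "is")
  case Nil
  then show ?case by simp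
next
  case (Cons i "is")
  have car: "prod_list_mat n (map (A(k := B)) is) \<in> carrier_mat n n" if "B \<in> carrier_mat n n" for B
    using A that by (intro prod_list_mat_carrier) auto
  show ?case
  proof (cases "i = k")
    case True
    then have "map (A(k := B)) is = map A is" for B
      using Cons.prems by auto
    moreover have R: "prod_list_mat n (map A is) \<in> carrier_mat n n"
      using A by (intro prod_list_mat_carrier) auto
    moreover have "(s \<cdot>\<^sub>m P + t \<cdot>\<^sub>m Q) * R = s \<cdot>\<^sub>m (P * R) + t \<cdot>\<^sub>m (Q * R)"
      if "R \<in> carrier_mat n n" for R
      using that P Q
      by (simp add: add_mult_distrib_mat[of _ n n _ _ n] mult_smult_assoc_mat[of _ n n _ n])
    ultimately show ?thesis
      using True by (simp only: list.map prod_list_mat_Cons fun_upd_same)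
  next
    case False
    have RP: "prod_list_mat n (map (A(k := P)) is) \<in> carrier_mat n n" (is "?RP \<in> _")
      and RQ: "prod_list_mat n (map (A(k := Q)) is) \<in> carrier_mat n n" (is "?RQ \<in> _")
      using car P Q by blast+
    have "A i * (s \<cdot>\<^sub>m ?RP + t \<cdot>\<^sub>m ?RQ) = s \<cdot>\<^sub>m (A i * ?RP) + t \<cdot>\<^sub>m (A i * ?RQ)"
      using A[of i] RP RQ
      by (simp add: mult_add_distrib_mat[of _ n n _ n] mult_smult_distrib[of _ n n _ n])
    moreover have "prod_list_mat n (map (A(k := s \<cdot>\<^sub>m P + t \<cdot>\<^sub>m Q)) is) = s \<cdot>\<^sub>m ?RP + t \<cdot>\<^sub>m ?RQ"
      using Cons.IH Cons.prems False by (auto simp del: fun_upd_apply)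
    ultimately show ?thesis
      using False by (simp only: list.map prod_list_mat_Cons fun_upd_other not_False_eq_True)
  qed
qed

lemma multilin_eval_index:
  "k < n \<Longrightarrow> l < n \<Longrightarrow> multilin_eval n m c A $$ (k, l) =
     (\<Sum>\<sigma>\<in>{\<sigma>. \<sigma> permutes {..<m}}. c \<sigma> * prod_list_mat n (map A (map \<sigma> [0..<m])) $$ (k, l))"
  by (simp add: multilin_eval_def comp_def)

lemma multilin_eval_carrier [simp]: "multilin_eval n m c A \<in> carrier_mat n n"
  by (simp add: multilin_eval_def)

lemma permutes_list:
  assumes "\<sigma> permutes {..<m}"
  shows "distinct (map \<sigma> [0..<m])" "set (map \<sigma> [0..<m]) = {..<m}"
  using permutes_inj_on[OF assms] permutes_image[OF assms]
  by (auto simp: distinct_map lessThan_atLeast0)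

lemma multilin_eval_cong:
  assumes "\<And>i. i < m \<Longrightarrow> A i = B i"
  shows "multilin_eval n m c A = multilin_eval n m c B"
proof (rule eq_matI)
  fix k l assume "k < dim_row (multilin_eval n m c B)" "l < dim_col (multilin_eval n m c B)"
  then have kl: "k < n" "l < n" by (auto simp: multilin_eval_def)
  have "map A (map \<sigma> [0..<m]) = map B (map \<sigma> [0..<m])" if "\<sigma> permutes {..<m}" for \<sigma>
    using permutes_list(2)[OF that] assms by (intro map_cong) auto
  then show "multilin_eval n m c A $$ (k, l) = multilin_eval n m c B $$ (k, l)"
    unfolding multilin_eval_index[OF kl] by (intro sum.cong refl) (simp only: mem_Collect_eq)
qed (auto simp: multilin_eval_def)

lemma multilin_eval_linear:
  assumes "k < m" "\<And>i. A i \<in> carrier_mat n n" "P \<in> carrier_mat n n" "Q \<in> carrier_mat n n"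
    and ij: "i < n" "j < n"
  shows "multilin_eval n m c (A(k := s \<cdot>\<^sub>m P + t \<cdot>\<^sub>m Q)) $$ (i, j) =
    s * multilin_eval n m c (A(k := P)) $$ (i, j) + t * multilin_eval n m c (A(k := Q)) $$ (i, j)"
proof -
  have "prod_list_mat n (map (A(k := s \<cdot>\<^sub>m P + t \<cdot>\<^sub>m Q)) (map \<sigma> [0..<m])) $$ (i, j) =
    s * prod_list_mat n (map (A(k := P)) (map \<sigma> [0..<m])) $$ (i, j) +
    t * prod_list_mat n (map (A(k := Q)) (map \<sigma> [0..<m])) $$ (i, j)"
    if "\<sigma> permutes {..<m}" for \<sigma>
  proof -
    have car: "prod_list_mat n (map (A(k := B)) (map \<sigma> [0..<m])) \<in> carrier_mat n n"
      if "B \<in> carrier_mat n n" for B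
      using assms that by (intro prod_list_mat_carrier) auto
    have "prod_list_mat n (map (A(k := s \<cdot>\<^sub>m P + t \<cdot>\<^sub>m Q)) (map \<sigma> [0..<m])) =
      s \<cdot>\<^sub>m prod_list_mat n (map (A(k := P)) (map \<sigma> [0..<m])) +
      t \<cdot>\<^sub>m prod_list_mat n (map (A(k := Q)) (map \<sigma> [0..<m]))"
      using assms permutes_list[OF that] by (intro prod_list_mat_linear) auto
    then show ?thesis
      using car[OF assms(3)] car[OF assms(4)] ij by (simp del: map_map fun_upd_apply)
  qed
  then show ?thesis
    unfolding multilin_eval_index[OF ij]
    by (simp del: map_map fun_upd_apply add: sum_distrib_left sum.distrib[symmetric] algebra_simps)
qed

lemma prod_list_mat_conjugate:
  assumes S: "S \<in> carrier_mat n n" "S' \<in> carrier_mat n n" "S * S' = 1\<^sub>m n" "S' * S = 1\<^sub>m n"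
    and A: "\<And>i. A i \<in> carrier_mat n n"
  shows "prod_list_mat n (map (\<lambda>i. S * A i * S') is) = S * prod_list_mat n (map A is) * S'"
proof (induction "is")
  case Nil
  then show ?case using S by (simp add: prod_list_mat_def)
next
  case (Cons i "is")
  note asc = assoc_mult_mat[of _ n n _ n _ n] and car = mult_carrier_mat[of _ n n _ n]
  define R where "R = prod_list_mat n (map A is)"
  have R: "R \<in> carrier_mat n n" unfolding R_def using A by (intro prod_list_mat_carrier) auto
  have "S * A i * S' * (S * R * S') = S * A i * (S' * S) * (R * S')"
    using S(1,2) A[of i] R by (simp add: asc car)
  also have "\<dots> = S * (A i * R) * S'"
    using S(1,2) A[of i] R by (simp add: asc car S(4))
  finally show ?case
    using Cons by (simp add: prod_list_mat_Cons R_def)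
qed

text \<open>Inside each monomial the factors \<open>S' * S\<close> cancel. The image of a
  multilinear polynomial is therefore stable under conjugation, which carries vanishing from
  diagonal to diagonalizable matrices.\<close>

lemma multilin_eval_conjugate:
  fixes A :: "nat \<Rightarrow> 'a::field mat"
  assumes S: "S \<in> carrier_mat n n" "S' \<in> carrier_mat n n" "S * S' = 1\<^sub>m n"
    and A: "\<And>i. A i \<in> carrier_mat n n"
  shows "multilin_eval n m c (\<lambda>i. S * A i * S') = S * multilin_eval n m c A * S'"
proof -
  have S': "S' * S = 1\<^sub>m n" using mat_mult_left_right_inverse[OF S] .
  have ent: "(S * X * S') $$ (k, l) = (\<Sum>i<n. \<Sum>j<n. S $$ (k, i) * (X $$ (i, j) * S' $$ (j, l)))"
    if "X \<in> carrier_mat n n" "k < n" "l < n" for X k l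
    using that S(1,2) by (simp add: scalar_prod_def sum_distrib_left lessThan_atLeast0)
  show ?thesis
  proof (rule eq_matI)
    fix k l assume "k < dim_row (S * multilin_eval n m c A * S')" "l < dim_col (S * multilin_eval n m c A * S')"
    then have kl: "k < n" "l < n" using S by auto
    define X where "X \<sigma> = prod_list_mat n (map A (map \<sigma> [0..<m]))" for \<sigma>
    have X: "X \<sigma> \<in> carrier_mat n n" for \<sigma>
      unfolding X_def using A by (intro prod_list_mat_carrier) auto
    have "multilin_eval n m c (\<lambda>i. S * A i * S') $$ (k, l) =
        (\<Sum>\<sigma>\<in>{\<sigma>. \<sigma> permutes {..<m}}. c \<sigma> * (S * X \<sigma> * S') $$ (k, l))"
      unfolding multilin_eval_index[OF kl] prod_list_mat_conjugate[OF S S' A] X_def ..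
    also have "\<dots> = (\<Sum>\<sigma>\<in>{\<sigma>. \<sigma> permutes {..<m}}. \<Sum>i<n. \<Sum>j<n. S $$ (k, i) * (c \<sigma> * X \<sigma> $$ (i, j) * S' $$ (j, l)))"
      unfolding ent[OF X kl] by (simp add: sum_distrib_left mult_ac)
    also have "\<dots> = (\<Sum>i<n. \<Sum>j<n. \<Sum>\<sigma>\<in>{\<sigma>. \<sigma> permutes {..<m}}. S $$ (k, i) * (c \<sigma> * X \<sigma> $$ (i, j) * S' $$ (j, l)))"
      by (subst sum.swap, intro sum.cong refl, rule sum.swap)
    also have "\<dots> = (\<Sum>i<n. \<Sum>j<n. S $$ (k, i) * (multilin_eval n m c A $$ (i, j) * S' $$ (j, l)))"
      unfolding X_def by (intro sum.cong refl) (simp add: multilin_eval_index sum_distrib_left sum_distrib_right del: map_map)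
    also have "\<dots> = (S * multilin_eval n m c A * S') $$ (k, l)"
      using ent[OF multilin_eval_carrier kl] by simp
    finally show "multilin_eval n m c (\<lambda>i. S * A i * S') $$ (k, l) = (S * multilin_eval n m c A * S') $$ (k, l)" .
  qed (use S in \<open>auto simp: multilin_eval_def\<close>)
qed

section \<open>Small determinants and the trace\<close>

lemma det_2:
  assumes "A \<in> carrier_mat 2 2"
  shows "det A = A $$ (0, 0) * A $$ (1, 1) - A $$ (0, 1) * A $$ (1, 0)"
proof -
  have "{..<2} = {0, 1 :: nat}" by auto
  then show ?thesis
    using assms by (subst laplace_expansion_column[of A 2 0]) (auto simp: cofactor_def mat_delete_def det_single)
qed

lemma det_3:
  assumes A: "A \<in> carrier_mat 3 3"
  shows "det A = A $$ (0, 0) * (A $$ (1, 1) * A $$ (2, 2) - A $$ (1, 2) * A $$ (2, 1))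
    - A $$ (1, 0) * (A $$ (0, 1) * A $$ (2, 2) - A $$ (0, 2) * A $$ (2, 1))
    + A $$ (2, 0) * (A $$ (0, 1) * A $$ (1, 2) - A $$ (0, 2) * A $$ (1, 1))"
proof -
  have 3: "{..<3} = {0, 1, 2 :: nat}" by auto
  have "det (mat_delete A i 0) =
      mat_delete A i 0 $$ (0, 0) * mat_delete A i 0 $$ (1, 1) - mat_delete A i 0 $$ (0, 1) * mat_delete A i 0 $$ (1, 0)"
    for i
    using A by (intro det_2) (simp add: mat_delete_def)
  then show ?thesis
    using A by (subst laplace_expansion_column[OF A, of 0]) (simp_all add: 3 cofactor_def, simp add: mat_delete_def numeral_2_eq_2 algebra_simps)
qed

text \<open>Reads the trace off the characteristic polynomial, through which the eigenvalues are
  given.\<close>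

lemma coeff_char_poly_3:
  fixes A :: "'a::comm_ring_1 mat"
  assumes A: "A \<in> carrier_mat 3 3"
  shows "coeff (char_poly A) 2 = - (A $$ (0, 0) + A $$ (1, 1) + A $$ (2, 2))"
  unfolding char_poly_def det_3[OF char_poly_matrix_closed[OF A]]
  using A by (simp add: char_poly_matrix_def coeff_mult numeral_2_eq_2)

section \<open>The grading by the cyclic group of order three\<close>

text \<open>The \<open>g\<close>-th component of the \<open>\<int>/3\<close>-grading of the \<open>3 \<times> 3\<close> matrices is spanned by the
  matrix units with index \<open>(k, k + g)\<close>, and has the coordinates \<open>x\<close>.\<close>

definition graded_mat :: "nat \<Rightarrow> (nat \<Rightarrow> 'a::zero) \<Rightarrow> 'a mat" where
  "graded_mat g x = mat 3 3 (\<lambda>(k, l). if l = (k + g) mod 3 then x k else 0)"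

lemma graded_mat_carrier [simp]: "graded_mat g x \<in> carrier_mat 3 3"
  by (simp add: graded_mat_def)

text \<open>Adding 3 first keeps the subtraction of natural numbers from truncating; the degree is
  \<open>s - r\<close> modulo 3.\<close>

lemma matrix_unit_graded:
  assumes "r < 3" "s < 3"
  shows "matrix_unit 3 r s = graded_mat ((s + 3 - r) mod 3) (\<lambda>k. if k = r then 1 else 0)"
proof -
  have "(r + (s + 3 - r) mod 3) mod 3 = s"
    using assms by (simp add: mod_add_right_eq)
  then show ?thesis
    by (intro eq_matI) (auto simp: matrix_unit_def graded_mat_def)
qed

lemma graded_mat_linear:
  fixes p q :: "nat \<Rightarrow> 'a::comm_ring_1"
  shows "graded_mat g (\<lambda>i. s * p i + t * q i) = s \<cdot>\<^sub>m graded_mat g p + t \<cdot>\<^sub>m graded_mat g q"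
  by (rule eq_matI) (auto simp: graded_mat_def)

text \<open>Degrees add along a product: row \<open>k\<close> of the first factor can be nonzero
  only in column \<open>k + g i\<close> modulo 3, and this is the row in which the remaining product
  is read.\<close>

lemma prod_list_mat_graded:
  fixes x :: "nat \<Rightarrow> nat \<Rightarrow> 'a::comm_ring_1"
  assumes "k < 3" "l < 3" "l \<noteq> (k + (\<Sum>i\<leftarrow>is. g i)) mod 3"
  shows "prod_list_mat 3 (map (\<lambda>i. graded_mat (g i) (x i)) is) $$ (k, l) = 0"
  using assms
proof (induction "is" arbitrary: k)
  case Nil
  then show ?case by (auto simp: prod_list_mat_def)
next
  case (Cons i "is")
  define R where "R = prod_list_mat 3 (map (\<lambda>i. graded_mat (g i) (x i)) is)"
  have R: "R \<in> carrier_mat 3 3" unfolding R_def by (intro prod_list_mat_carrier) auto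
  have "graded_mat (g i) (x i) $$ (k, h) * R $$ (h, l) = 0" if "h < 3" for h
  proof (cases "h = (k + g i) mod 3")
    case True
    then have "(h + (\<Sum>i\<leftarrow>is. g i)) mod 3 = (k + (\<Sum>i\<leftarrow>i # is. g i)) mod 3"
      by (simp add: mod_add_left_eq add.assoc)
    then have "R $$ (h, l) = 0"
      unfolding R_def using Cons.prems that by (intro Cons.IH) auto
    then show ?thesis by simp
  next
    case False
    then show ?thesis using Cons.prems that by (simp add: graded_mat_def)
  qed
  then show ?case
    using Cons.prems R
    by (simp add: prod_list_mat_Cons R_def[symmetric] index_mult_mat_3 del: index_mult_mat(1) One_nat_def)
qed

text \<open>All monomials have the same factors in different orders, hence the same degree.\<close>

lemma multilin_eval_graded:
  fixes x :: "nat \<Rightarrow> nat \<Rightarrow> 'a::comm_ring_1"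
  assumes kl: "k < 3" "l < 3" "l \<noteq> (k + (\<Sum>i<m. g i)) mod 3"
  shows "multilin_eval 3 m c (\<lambda>i. graded_mat (g i) (x i)) $$ (k, l) = 0"
proof -
  have "prod_list_mat 3 (map (\<lambda>i. graded_mat (g i) (x i)) (map \<sigma> [0..<m])) $$ (k, l) = 0"
    if "\<sigma> permutes {..<m}" for \<sigma>
  proof (rule prod_list_mat_graded)
    have "(\<Sum>i\<leftarrow>map \<sigma> [0..<m]. g i) = (\<Sum>i\<in>set (map \<sigma> [0..<m]). g i)"
      using permutes_list(1)[OF that] by (rule sum_list_distinct_conv_sum_set)
    then show "l \<noteq> (k + (\<Sum>i\<leftarrow>map \<sigma> [0..<m]. g i)) mod 3"
      using kl permutes_list(2)[OF that] by simp
  qed (use kl in auto)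
  then show ?thesis
    unfolding multilin_eval_index[OF kl(1,2)] by (intro sum.neutral) (simp del: map_map)
qed

text \<open>Reducing the index modulo 3 extends the three diagonal entries to all of
  \<open>nat\<close>, where a cyclic rotation becomes a shift by one.\<close>

lemma multilin_eval_graded_multilinear:
  fixes c :: "(nat \<Rightarrow> nat) \<Rightarrow> 'a::comm_ring_1"
  shows "multilinear_upto m (\<lambda>x j. multilin_eval 3 m c (\<lambda>i. graded_mat (g i) (x i)) $$ (j mod 3, j mod 3))"
  unfolding multilinear_upto_def
proof (intro conjI allI impI)
  fix k and x :: "nat \<Rightarrow> nat \<Rightarrow> 'a" and p q s t and j :: nat
  assume "k < m"
  have upd: "(\<lambda>i. graded_mat (g i) ((x(k := u)) i)) = (\<lambda>i. graded_mat (g i) (x i))(k := graded_mat (g k) u)" for u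
    by auto
  show "multilin_eval 3 m c (\<lambda>i. graded_mat (g i) ((x(k := \<lambda>i. s * p i + t * q i)) i)) $$ (j mod 3, j mod 3) =
      s * multilin_eval 3 m c (\<lambda>i. graded_mat (g i) ((x(k := p)) i)) $$ (j mod 3, j mod 3) +
      t * multilin_eval 3 m c (\<lambda>i. graded_mat (g i) ((x(k := q)) i)) $$ (j mod 3, j mod 3)"
    unfolding upd graded_mat_linear using \<open>k < m\<close> by (intro multilin_eval_linear) auto
next
  fix x y :: "nat \<Rightarrow> nat \<Rightarrow> 'a"
  assume "\<forall>i<m. x i = y i"
  then have "multilin_eval 3 m c (\<lambda>i. graded_mat (g i) (x i)) = multilin_eval 3 m c (\<lambda>i. graded_mat (g i) (y i))"
    by (intro multilin_eval_cong) auto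
  then show "(\<lambda>j. multilin_eval 3 m c (\<lambda>i. graded_mat (g i) (x i)) $$ (j mod 3, j mod 3)) =
      (\<lambda>j. multilin_eval 3 m c (\<lambda>i. graded_mat (g i) (y i)) $$ (j mod 3, j mod 3))"
    by simp
qed

text \<open>Conjugation by the cyclic permutation matrix preserves every graded component, shifts
  its coordinates and rotates the diagonal of the value.\<close>

lemma multilin_eval_graded_rotate:
  fixes x :: "nat \<Rightarrow> nat \<Rightarrow> 'a::field"
  assumes g: "\<And>i. g i < 3" and "j < 3"
  shows "multilin_eval 3 m c (\<lambda>i. graded_mat (g i) (\<lambda>k. x i (Suc k mod 3))) $$ (j, j) =
    multilin_eval 3 m c (\<lambda>i. graded_mat (g i) (x i)) $$ (Suc j mod 3, Suc j mod 3)"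
proof -
  define P P' :: "'a mat" where "P = mat 3 3 (\<lambda>(i, j). if j = Suc i mod 3 then 1 else 0)"
    and "P' = mat 3 3 (\<lambda>(i, j). if i = Suc j mod 3 then 1 else 0)"
  have P[simp]: "P \<in> carrier_mat 3 3" "P' \<in> carrier_mat 3 3" by (auto simp: P_def P'_def)
  have shift: "(P * A * P') $$ (k, l) = A $$ (Suc k mod 3, Suc l mod 3)"
    if "A \<in> carrier_mat 3 3" "k < 3" "l < 3" for A k l
    using that by (elim less_3_cases[of k] less_3_cases[of l])
      (simp_all add: index_mult_mat_3 del: index_mult_mat(1), simp_all add: P_def P'_def numeral_2_eq_2)
  have PP': "P * P' = 1\<^sub>m 3"
    by (intro mat_eq_3; (elim less_3_cases)?)
      (simp_all add: index_mult_mat_3 del: index_mult_mat(1), simp_all add: P_def P'_def)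
  have "graded_mat h (\<lambda>k. y (Suc k mod 3)) = P * graded_mat h y * P'" if "h < 3" for h and y :: "nat \<Rightarrow> 'a"
    using that by (intro mat_eq_3; (elim less_3_cases)?)
      (simp_all add: shift del: index_mult_mat(1), simp_all add: graded_mat_def)
  then have "multilin_eval 3 m c (\<lambda>i. graded_mat (g i) (\<lambda>k. x i (Suc k mod 3))) =
      multilin_eval 3 m c (\<lambda>i. P * graded_mat (g i) (x i) * P')"
    using g by (intro multilin_eval_cong) blast
  also have "\<dots> = P * multilin_eval 3 m c (\<lambda>i. graded_mat (g i) (x i)) * P'"
    by (rule multilin_eval_conjugate) (auto simp: PP')
  finally show ?thesis
    using shift[OF multilin_eval_carrier \<open>j < 3\<close> \<open>j < 3\<close>] by simp
qed

section \<open>Circulant determinants and cube roots of unity\<close>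

lemma circulant_kernel_trivial:
  fixes d0 d1 d2 :: "'a::idom"
  assumes "(d0 + d1 + d2) * ((d0 + d1 + d2)^2 - 3 * (d0 * d1 + d1 * d2 + d2 * d0)) \<noteq> 0"
    and e0: "n0 * d0 + n1 * d1 + n2 * d2 = 0"
    and e1: "n0 * d1 + n1 * d2 + n2 * d0 = 0"
    and e2: "n0 * d2 + n1 * d0 + n2 * d1 = 0"
  shows "n0 = 0 \<and> n1 = 0 \<and> n2 = 0"
proof -
  \<comment> \<open>Minus the determinant of the circulant system. Its form in elementary symmetric
    functions makes the order of \<open>d0\<close>, \<open>d1\<close>, \<open>d2\<close>
    immaterial.\<close>
  define \<Delta> where "\<Delta> = (d0 + d1 + d2) * ((d0 + d1 + d2)^2 - 3 * (d0 * d1 + d1 * d2 + d2 * d0))"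
  \<comment> \<open>The negated cofactors of the circulant matrix; the identities below are Cramer's
    rule.\<close>
  define u v w where "u = d0 * d0 - d1 * d2" and "v = d1 * d1 - d0 * d2" and "w = d2 * d2 - d0 * d1"
  have "\<Delta> * n0 = u * (n0 * d0 + n1 * d1 + n2 * d2) + v * (n0 * d1 + n1 * d2 + n2 * d0) + w * (n0 * d2 + n1 * d0 + n2 * d1)"
    "\<Delta> * n1 = v * (n0 * d0 + n1 * d1 + n2 * d2) + w * (n0 * d1 + n1 * d2 + n2 * d0) + u * (n0 * d2 + n1 * d0 + n2 * d1)"
    "\<Delta> * n2 = w * (n0 * d0 + n1 * d1 + n2 * d2) + u * (n0 * d1 + n1 * d2 + n2 * d0) + v * (n0 * d2 + n1 * d0 + n2 * d1)"
    unfolding \<Delta>_def u_def v_def w_def by (simp_all add: algebra_simps power2_eq_square)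
  then show ?thesis
    using assms(1) unfolding e0 e1 e2 \<Delta>_def[symmetric] by simp
qed

text \<open>Comparing coefficients avoids matching the two lists of roots by a permutation.\<close>

lemma cubic_roots_symmetric:
  fixes a b c :: "'a::comm_ring_1"
  assumes "[:-a, 1:] * [:-b, 1:] * [:-c, 1:] = [:-a', 1:] * [:-b', 1:] * [:-c', 1:]"
  shows "a + b + c = a' + b' + c'" "a * b + b * c + c * a = a' * b' + b' * c' + c' * a'"
proof -
  have "[:-u, 1:] * [:-v, 1:] * [:-w, 1:] = [:- (u * v * w), u * v + v * w + w * u, - (u + v + w), 1:]"
    for u v w :: 'a
    by (simp add: algebra_simps)
  then have "[:- (a * b * c), a * b + b * c + c * a, - (a + b + c), 1:] =
      [:- (a' * b' * c'), a' * b' + b' * c' + c' * a', - (a' + b' + c'), 1:]"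
    using assms by metis
  then show "a + b + c = a' + b' + c'" "a * b + b * c + c * a = a' * b' + b' * c' + c' * a'"
    by (simp_all only: pCons_eq_iff neg_equal_iff_equal)
qed

text \<open>The two linear forms in \<epsilon> multiply to the second factor, which uses only
  \<open>\<epsilon>^2 + \<epsilon> + 1 = 0\<close>; in characteristic 3 this relation reads
  \<open>1 + 1 + 1 = 0\<close>.\<close>

lemma circulant_det_nonzero:
  fixes \<epsilon> \<alpha> \<beta> \<gamma> :: "'a::idom"
  assumes eps: "if CHAR('a) \<noteq> 3 then \<epsilon> ^ 3 = 1 \<and> \<epsilon> \<noteq> 1 else \<epsilon> = 1"
    and h1: "\<alpha> + \<beta> + \<gamma> \<noteq> 0"
    and h2: "\<alpha> + \<beta> * \<epsilon> + \<gamma> * \<epsilon>\<^sup>2 \<noteq> 0"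
    and h3: "\<alpha> + \<beta> * \<epsilon>\<^sup>2 + \<gamma> * \<epsilon> \<noteq> 0"
  shows "(\<alpha> + \<beta> + \<gamma>) * ((\<alpha> + \<beta> + \<gamma>)\<^sup>2 - 3 * (\<alpha> * \<beta> + \<beta> * \<gamma> + \<gamma> * \<alpha>)) \<noteq> 0"
proof -
  have "\<epsilon>\<^sup>2 + \<epsilon> + 1 = 0"
  proof (cases "CHAR('a) = 3")
    case True
    then have "(of_nat 3 :: 'a) = 0" using of_nat_CHAR[where 'a = 'a] by simp
    then show ?thesis using eps True by simp
  next
    case False
    then have "(\<epsilon> - 1) * (\<epsilon>\<^sup>2 + \<epsilon> + 1) = 0" "\<epsilon> - 1 \<noteq> 0"
      using eps by (simp_all add: algebra_simps power2_eq_square power3_eq_cube)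
    then show ?thesis by simp
  qed
  then have "\<epsilon>\<^sup>2 + (\<epsilon> + 1) = 0" by (simp add: add.assoc)
  then have eps2: "\<epsilon>\<^sup>2 = - \<epsilon> - 1" by (metis add_eq_0_iff2 minus_add_distrib uminus_add_conv_diff add.commute diff_conv_add_uminus)
  have "\<epsilon> * \<epsilon>\<^sup>2 = \<epsilon> * (- \<epsilon> - 1)" by (simp only: eps2)
  also have "\<dots> = - \<epsilon>\<^sup>2 - \<epsilon>" by (simp add: algebra_simps power2_eq_square)
  also have "\<dots> = 1" by (simp add: eps2)
  finally have eps3: "\<epsilon> * \<epsilon>\<^sup>2 = 1" .
  have "(\<alpha> + \<beta> * \<epsilon> + \<gamma> * \<epsilon>\<^sup>2) * (\<alpha> + \<beta> * \<epsilon>\<^sup>2 + \<gamma> * \<epsilon>) =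
      \<alpha>\<^sup>2 + (\<beta>\<^sup>2 + \<gamma>\<^sup>2) * (\<epsilon> * \<epsilon>\<^sup>2) + \<alpha> * (\<beta> + \<gamma>) * (\<epsilon> + \<epsilon>\<^sup>2)
      + \<beta> * \<gamma> * (\<epsilon>\<^sup>2 + \<epsilon> * (\<epsilon> * \<epsilon>\<^sup>2))"
    by (simp add: algebra_simps power2_eq_square)
  also have "\<dots> = (\<alpha> + \<beta> + \<gamma>)\<^sup>2 - 3 * (\<alpha> * \<beta> + \<beta> * \<gamma> + \<gamma> * \<alpha>)"
    unfolding eps3 unfolding eps2 by (simp add: algebra_simps power2_eq_square)
  finally show ?thesis using h1 h2 h3 by (metis mult_eq_0_iff)
qed

theorem theorem3p13:
  fixes \<epsilon> \<alpha> \<beta> \<gamma> :: "'a::alg_closed_field"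
    and m :: nat
    and c :: "(nat \<Rightarrow> nat) \<Rightarrow> 'a"
    and E :: "nat \<Rightarrow> 'a mat"
  assumes eps: "if CHAR('a) \<noteq> 3 then \<epsilon> ^ 3 = 1 \<and> \<epsilon> \<noteq> 1 else \<epsilon> = 1"
    and h1: "\<alpha> + \<beta> + \<gamma> \<noteq> 0"
    and h2: "\<alpha> + \<beta> * \<epsilon> + \<gamma> * \<epsilon>\<^sup>2 \<noteq> 0"
    and h3: "\<alpha> + \<beta> * \<epsilon>\<^sup>2 + \<gamma> * \<epsilon> \<noteq> 0"
    and units: "\<forall>i<m. is_matrix_unit 3 (E i)"
    and eig: "char_poly (multilin_eval 3 m c E) = [:-\<alpha>, 1:] * [:-\<beta>, 1:] * [:-\<gamma>, 1:]"
  shows "zariski_dense_mat 3 (multilin_image 3 m c)"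
proof -
  obtain r s where rs: "\<And>i. i < m \<Longrightarrow> r i < 3 \<and> s i < 3 \<and> E i = matrix_unit 3 (r i) (s i)"
    using units unfolding is_matrix_unit_def by metis
  define g where "g i = (s i + 3 - r i) mod 3" for i
  define x0 :: "nat \<Rightarrow> nat \<Rightarrow> 'a" where "x0 i k = (if k = r i then 1 else 0)" for i k
  \<comment> \<open>Each argument now ranges over the whole graded component that contains
    \<open>E i\<close>.\<close>
  define X where "X x = multilin_eval 3 m c (\<lambda>i. graded_mat (g i) (x i))" for x
  define F where "F x j = X x $$ (j mod 3, j mod 3)" for x and j :: nat
  have g3: "g i < 3" for i by (simp add: g_def)
  have X_carrier: "X x \<in> carrier_mat 3 3" for x by (simp add: X_def)
  have "E i = graded_mat (g i) (x0 i)" if "i < m" for i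
    using rs[OF that] matrix_unit_graded[of "r i" "s i"] by (simp add: g_def x0_def[abs_def])
  then have XE: "multilin_eval 3 m c E = X x0"
    unfolding X_def by (intro multilin_eval_cong)
  have graded: "X x $$ (k, l) = 0" if "k < 3" "l < 3" "l \<noteq> (k + (\<Sum>i<m. g i)) mod 3" for x k l
    unfolding X_def using that by (rule multilin_eval_graded)
  \<comment> \<open>Otherwise the value at the matrix units would have zero diagonal, hence trace 0,
    contradicting \<open>\<alpha> + \<beta> + \<gamma> \<noteq> 0\<close>.\<close>
  have degree_0: "(\<Sum>i<m. g i) mod 3 = 0"
  proof (rule ccontr)
    assume ne: "(\<Sum>i<m. g i) mod 3 \<noteq> 0"
    have "k \<noteq> (k + N) mod 3" if "k < 3" "N mod 3 \<noteq> 0" for k N :: nat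
      using that by presburger
    then have "X x0 $$ (k, k) = 0" if "k < 3" for k
      using that ne by (intro graded) blast+
    then have "coeff (char_poly (X x0)) 2 = 0"
      by (simp add: coeff_char_poly_3[OF X_carrier])
    moreover have "coeff (char_poly (X x0)) 2 = - (\<alpha> + \<beta> + \<gamma>)"
      using eig by (simp add: XE numeral_2_eq_2)
    ultimately show False using h1 by (metis neg_equal_0_iff_equal)
  qed
  have "(k + N) mod 3 = k" if "k < 3" "N mod 3 = 0" for k N :: nat
    using that by presburger
  then have off_diag: "X x $$ (k, l) = 0" if "k < 3" "l < 3" "k \<noteq> l" for x k l
    using that degree_0 by (intro graded) metis+
  have X_diag: "X x = diag3 (F x 0, F x 1, F x 2)" for x
    by (intro mat_eq_3; (elim less_3_cases)?)
       (simp_all add: X_carrier, simp_all add: off_diag F_def diag3_def)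

  define d0 d1 d2 where "d0 = F x0 0" and "d1 = F x0 1" and "d2 = F x0 2"
  have "char_poly (X x0) = (\<Prod>a\<leftarrow>diag_mat (X x0). [:- a, 1:])"
    by (rule char_poly_upper_triangular[OF X_carrier]) (use X_carrier[of x0] off_diag in \<open>auto simp: upper_triangular_def\<close>)
  also have "\<dots> = [:- d0, 1:] * [:- d1, 1:] * [:- d2, 1:]"
    using X_carrier[of x0] by (simp add: diag_mat_def d0_def d1_def d2_def F_def upt_rec numeral_2_eq_2 algebra_simps)
  finally have "[:- d0, 1:] * [:- d1, 1:] * [:- d2, 1:] = [:-\<alpha>, 1:] * [:-\<beta>, 1:] * [:-\<gamma>, 1:]"
    using eig XE by simp
  then have circ: "(d0 + d1 + d2) * ((d0 + d1 + d2)\<^sup>2 - 3 * (d0 * d1 + d1 * d2 + d2 * d0)) \<noteq> 0"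
    using circulant_det_nonzero[OF eps h1 h2 h3] cubic_roots_symmetric by metis
  have rot: "F (\<lambda>i k. x i (Suc k mod 3)) j = F x (Suc j)" for x j
    using multilin_eval_graded_rotate[OF g3, where j = "j mod 3" and m = m and c = c and x = x]
    by (simp add: F_def X_def mod_Suc_eq)
  \<comment> \<open>A functional vanishing on all values vanishes at \<open>x0\<close> and its two
    rotations, which is a circulant system with coefficients \<open>d0\<close>, \<open>d1\<close>,
    \<open>d2\<close>.\<close>
  have span: "n0 = 0 \<and> n1 = 0 \<and> n2 = 0"
    if "\<And>x. n0 * F x 0 + n1 * F x 1 + n2 * F x 2 = 0" for n0 n1 n2
  proof (rule circulant_kernel_trivial[OF circ])
    define x1 x2 where "x1 = (\<lambda>i k. x0 i (Suc k mod 3))" and "x2 = (\<lambda>i k. x1 i (Suc k mod 3))"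
    have [simp]: "F x (Suc (Suc (Suc 0))) = F x 0" "F x (Suc (Suc (Suc (Suc 0)))) = F x 1" for x
      by (simp_all add: F_def)
    have x1: "F x1 j = F x0 (Suc j)" and x2: "F x2 j = F x1 (Suc j)" for j
      unfolding x1_def x2_def by (rule rot)+
    have "F x1 0 = d1" "F x1 1 = d2" "F x1 2 = d0" "F x2 0 = d2" "F x2 1 = d0" "F x2 2 = d1"
      unfolding x2 x1 d0_def d1_def d2_def by (simp_all add: numeral_2_eq_2)
    then show "n0 * d0 + n1 * d1 + n2 * d2 = 0" "n0 * d1 + n1 * d2 + n2 * d0 = 0"
      "n0 * d2 + n1 * d0 + n2 * d1 = 0"
      using that[of x0] that[of x1] that[of x2] by (simp_all add: d0_def d1_def d2_def)
  qed
  have F: "multilinear_upto m F"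
    unfolding F_def X_def by (rule multilin_eval_graded_multilinear)

  show ?thesis unfolding zariski_dense_mat_def
  proof (intro conjI allI impI)
    show "multilin_image 3 m c \<subseteq> carrier_mat 3 3"
      by (auto simp: multilin_image_def)
  next
    fix f :: "(nat \<times> nat \<Rightarrow> nat) \<Rightarrow> 'a" and e
    assume f: "entry_poly 3 f" and van: "\<forall>A\<in>multilin_image 3 m c. entry_poly_eval 3 f A = 0"
    \<comment> \<open>Conjugates of \<open>X x\<close> lie in the image, so \<open>f\<close> pulled
      back along \<open>v \<mapsto> S * diag3 v * S'\<close> is a polynomial vanishing on the values
      of \<open>F\<close>, to which the density of these values applies.\<close>
    have diag: "entry_poly_eval 3 f (S * diag3 v * S') = 0"
      if S: "S \<in> carrier_mat 3 3" "S' \<in> carrier_mat 3 3" "S * S' = 1\<^sub>m 3" for S S' v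
    proof (rule multilinear_upto_dense[OF F span, of "\<lambda>v. entry_poly_eval 3 f (S * diag3 v * S')"])
      have "(\<lambda>v. diag3 v $$ (i, j)) \<in> (poly_fun3 :: ('a \<times> 'a \<times> 'a \<Rightarrow> 'a) set)" if "i < 3" "j < 3" for i j
        using that
        by (elim less_3_cases) (simp_all add: diag3_def case_prod_unfold poly_fun3_coords subalgebra_const[OF poly_fun3_subalgebra])
      then show "(\<lambda>v. entry_poly_eval 3 f (S * diag3 v * S')) \<in> poly_fun3"
        by (intro subalgebra_entry_poly_eval[OF poly_fun3_subalgebra]
              subalgebra_mat_mult[OF poly_fun3_subalgebra, where n = 3])
           (auto intro!: S subalgebra_const[OF poly_fun3_subalgebra] mult_carrier_mat_3)
    next
      fix x
      have "S * X x * S' = multilin_eval 3 m c (\<lambda>i. S * graded_mat (g i) (x i) * S')"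
        unfolding X_def using S by (intro multilin_eval_conjugate[symmetric]) auto
      also have "\<dots> \<in> multilin_image 3 m c"
        unfolding multilin_image_def using S by auto
      finally show "entry_poly_eval 3 f (S * diag3 (F x 0, F x 1, F x 2) * S') = 0"
        using van X_diag by metis
    qed auto
    show "f e = 0"
    proof (rule coeffs_zero_if_eval_zero[where I = "{..<3} \<times> {..<3}"])
      fix x :: "nat \<times> nat \<Rightarrow> 'a"
      have "entry_poly_eval 3 f (mat 3 3 x) = 0"
        using diag by (rule entry_poly_eval_zero_if_zero_on_diagonalizable) auto
      moreover have "(\<Prod>ij\<in>{..<3} \<times> {..<3}. (mat 3 3 x $$ ij) ^ e ij) = (\<Prod>ij\<in>{..<3} \<times> {..<3}. x ij ^ e ij)" for e
        by (intro prod.cong) auto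
      ultimately show "(\<Sum>e | f e \<noteq> 0. f e * (\<Prod>ij\<in>{..<3} \<times> {..<3}. x ij ^ e ij)) = 0"
        by (simp add: entry_poly_eval_def)
    next
      fix e and ij :: "nat \<times> nat"
      assume "f e \<noteq> 0" "ij \<notin> {..<3} \<times> {..<3}"
      then show "e ij = 0"
        using f by (cases ij) (auto simp: entry_poly_def not_less)
    qed (use f in \<open>auto simp: entry_poly_def\<close>)
  qed
qed

end
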